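(* Let $N\equiv3\pmod 4$ be a positive integer, let $\omega=(1+\sqrt{-N})/2$, and let $\Lambda\subset\mathbb{C}\cong\mathbb{R}^2$ be the lattice generated by $1$ and $\omega$ (so $\Lambda=\mathbb{Z}[\omega]$, a lattice with hexagonal Voronoi cell). For $\alpha=a+b\omega$ with $a,b\in\mathbb{Z}$, $\alpha\ne0$, the sublattice $\alpha\Lambda$ is clean if and only if all of the following hold: (i) $\alpha\theta$ is primitive, where $\theta=\omega-\bar\omega=\sqrt{-N}$; (ii) there is an odd number $k$ dividing $N+1$ such that $\alpha(N-\theta)/(2k)$ is integral and primitive; (iii) there is an odd number $k$ dividing $N+1$ such that $\alpha(N+\theta)/(2k)$ is integral and primitive.
   Context: A sublattice $\Lambda'\subseteq\Lambda$ is clean if the boundaries of the Voronoi cells of $\Lambda'$ (in $\mathbb{R}^2$) contain no point of $\Lambda$. "Integral" means lying in $\mathbb{Z}[\omega]$; an element $r+s\omega\in\mathbb{Z}[\omega]$ ($r,s\in\mathbb{Z}$) is primitive if $\gcd(r,s)=1$. *)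

theory Defs
  imports "HOL-Analysis.Analysis"
begin

text \<open>The function \<^const>\<open>csqrt\<close> is the principal square root, so
  \<open>csqrt (- of_nat N)\<close> is \<open>\<i> * sqrt N\<close>.\<close>

definition omega :: "nat \<Rightarrow> complex" where
  "omega N = (1 + csqrt (- of_nat N)) / 2"

definition theta :: "nat \<Rightarrow> complex" where
  "theta N = omega N - cnj (omega N)"

definition lattice_omega :: "nat \<Rightarrow> complex set" where
  "lattice_omega N = {of_int r + of_int s * omega N | r s. True}"

text \<open>For \<open>N > 0\<close> the coordinates \<open>r\<close> and \<open>s\<close> below are determined by \<open>z\<close>, because \<open>1\<close> and
  \<open>omega N\<close> are linearly independent over the reals.\<close>

definition primitive_in :: "nat \<Rightarrow> complex \<Rightarrow> bool" where
  "primitive_in N z \<longleftrightarrow> (\<exists>r s :: int. z = of_int r + of_int s * omega N \<and> gcd r s = 1)"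

definition voronoi_cell :: "'a::metric_space set \<Rightarrow> 'a \<Rightarrow> 'a set" where
  "voronoi_cell L p = {x. \<forall>q\<in>L. dist x p \<le> dist x q}"

text \<open>Cleanness is a notion for sublattices: it is meant to be used with \<open>L' \<subseteq> L\<close>.\<close>

definition clean_in :: "'a::metric_space set \<Rightarrow> 'a set \<Rightarrow> bool" where
  "clean_in L L' \<longleftrightarrow> (\<forall>p\<in>L'. frontier (voronoi_cell L' p) \<inter> L = {})"

end

theory Submission
  imports Defs
begin

text \<open>The Voronoi cell of \<open>\<Lambda>\<close> at \<open>0\<close> is a hexagon whose edges lie, up to sign, on the lines
  \<open>e (1/2 + \<tau> \<theta>)\<close>, \<open>\<tau> \<in> \<real>\<close>, for \<open>e = 1, \<omega>, cnj \<omega>\<close>; the edge is cut out by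
  \<open>\<bar>\<tau>\<bar> \<le> (N - 1)/(4 N)\<close> for \<open>e = 1\<close> and by \<open>\<bar>\<tau>\<bar> \<le> 1/(2 N)\<close> in the two other cases. Put
  \<open>\<gamma> = \<alpha> e\<close> and write \<open>\<gamma> \<theta> = h \<beta>\<close> with \<open>\<beta>\<close> primitive. If \<open>h\<close> is even, then the midpoint
  \<open>\<gamma>/2\<close> is in \<open>\<Lambda>\<close>; if \<open>h\<close> is odd, then the points of \<open>\<Lambda>\<close> on the line closest to the midpoint
  are those with \<open>\<tau> = \<plusminus>1/(2 h)\<close>. For \<open>e = 1\<close> the edge therefore avoids \<open>\<Lambda>\<close> iff \<open>h = 1\<close>,
  which is (i). For the other two edges \<open>- \<theta> \<omega> = (N - \<theta>)/2\<close> and \<open>\<theta> (cnj \<omega>) = (N + \<theta>)/2\<close>;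
  there (i) and \<open>\<omega> (cnj \<omega>) = (N + 1)/4\<close> force \<open>h\<close> to divide \<open>(N + 1)/4 < N\<close>.\<close>

section \<open>The ring \<open>\<int>[\<omega>]\<close>\<close>

lemma omega_eq: "omega N = Complex (1/2) (sqrt N / 2)"
proof -
  have "csqrt (- of_nat N) = \<i> * sqrt N"
    by (simp add: complex_eq_iff)
  then show ?thesis
    by (simp add: omega_def complex_eq_iff)
qed

lemma theta_eq: "theta N = Complex 0 (sqrt N)"
  by (simp add: theta_def omega_eq complex_eq_iff)

lemma theta_conv_omega: "theta N = 2 * omega N - 1"
  by (simp add: omega_eq theta_eq complex_eq_iff)

lemma cnj_omega_eq: "cnj (omega N) = 1 - omega N"
  by (simp add: omega_eq complex_eq_iff)

lemma theta_squared: "theta N * theta N = - of_nat N"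
  by (simp add: theta_eq complex_eq_iff)

lemma omega_times_theta: "omega N * theta N = - ((of_nat N - theta N) / 2)"
  by (simp add: theta_eq omega_eq complex_eq_iff)

lemma cnj_omega_times_theta: "cnj (omega N) * theta N = (of_nat N + theta N) / 2"
  by (simp add: theta_eq omega_eq complex_eq_iff)

lemma omega_times_cnj:
  assumes "N + 1 = 4 * M"
  shows "omega N * cnj (omega N) = of_nat M"
proof -
  have "real N + 1 = 4 * real M"
    using assms by (metis of_nat_1 of_nat_add of_nat_mult of_nat_numeral)
  then show ?thesis
    by (simp add: omega_eq complex_eq_iff)
qed

lemma lattice_omegaI: "z = of_int r + of_int s * omega N \<Longrightarrow> z \<in> lattice_omega N"
  by (auto simp: lattice_omega_def)

lemma lattice_omegaE:
  assumes "z \<in> lattice_omega N"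
  obtains r s where "z = of_int r + of_int s * omega N"
  using assms by (auto simp: lattice_omega_def)

lemma omega_coords_unique:
  fixes x y x' y' :: real
  assumes "N > 0" "of_real x + of_real y * omega N = of_real x' + of_real y' * omega N"
  shows "x = x' \<and> y = y'"
  using assms by (auto simp: omega_eq complex_eq_iff)

lemma of_int_in_lattice: "of_int m \<in> lattice_omega N"
  by (rule lattice_omegaI[of _ m 0]) simp

lemma omega_in_lattice: "omega N \<in> lattice_omega N"
  by (rule lattice_omegaI[of _ 0 1]) simp

lemma cnj_omega_in_lattice: "cnj (omega N) \<in> lattice_omega N"
  by (rule lattice_omegaI[of _ 1 "-1"]) (simp add: cnj_omega_eq)

lemma theta_in_lattice: "theta N \<in> lattice_omega N"
  by (rule lattice_omegaI[of _ "-1" 2]) (simp add: theta_conv_omega)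

lemma lattice_add:
  assumes "z \<in> lattice_omega N" "w \<in> lattice_omega N"
  shows "z + w \<in> lattice_omega N"
proof -
  obtain r s r' s' where "z = of_int r + of_int s * omega N" "w = of_int r' + of_int s' * omega N"
    using assms by (auto elim!: lattice_omegaE)
  then show ?thesis
    by (intro lattice_omegaI[of _ "r + r'" "s + s'"]) (simp add: algebra_simps)
qed

lemma mod_four_three_obtain:
  fixes N :: nat
  assumes "N mod 4 = 3"
  obtains M where "N + 1 = 4 * M"
proof -
  have "4 dvd N + 1"
    using assms by presburger
  then show ?thesis
    using that by (auto elim: dvdE)
qed

text \<open>Closure under products comes down to \<open>omega N * omega N\<close>, which is
  \<open>omega N - M\<close> with \<open>M = (N + 1) / 4\<close>; that \<open>M\<close> is an
  integer is what \<open>N mod 4 = 3\<close> provides.\<close>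

lemma lattice_mult:
  assumes "N mod 4 = 3" "z \<in> lattice_omega N" "w \<in> lattice_omega N"
  shows "z * w \<in> lattice_omega N"
proof -
  obtain M where M: "N + 1 = 4 * M"
    using assms(1) by (rule mod_four_three_obtain)
  have sq: "omega N * omega N = omega N - of_nat M"
    using omega_times_cnj[OF M] by (simp add: cnj_omega_eq algebra_simps)
  obtain r s r' s' where eqs: "z = of_int r + of_int s * omega N"
    "w = of_int r' + of_int s' * omega N"
    using assms by (auto elim!: lattice_omegaE)
  have "z * w = of_int r * of_int r' + (of_int r * of_int s' + of_int s * of_int r') * omega N
      + of_int s * of_int s' * (omega N * omega N)"
    by (simp add: eqs algebra_simps)
  then show ?thesis
    by (intro lattice_omegaI[of _ "r * r' - s * s' * int M" "r * s' + s * r' + s * s'"])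
      (simp add: sq algebra_simps)
qed

lemma lattice_uminus:
  assumes "z \<in> lattice_omega N"
  shows "- z \<in> lattice_omega N"
proof -
  obtain r s where "z = of_int r + of_int s * omega N"
    using assms by (rule lattice_omegaE)
  then show ?thesis
    by (intro lattice_omegaI[of _ "- r" "- s"]) simp
qed

lemma lattice_of_int_mult:
  assumes "z \<in> lattice_omega N"
  shows "of_int m * z \<in> lattice_omega N"
proof -
  obtain r s where "z = of_int r + of_int s * omega N"
    using assms by (rule lattice_omegaE)
  then show ?thesis
    by (intro lattice_omegaI[of _ "m * r" "m * s"]) (simp add: algebra_simps)
qed

text \<open>Bezout for the coprime integers \<open>h\<close> and 2. It turns two easy memberships
  into one for a point that is defined with a denominator 2.\<close>

lemma lattice_odd_multiple:
  fixes h :: int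
  assumes "odd h" "of_int h * z \<in> lattice_omega N" "2 * z \<in> lattice_omega N"
  shows "z \<in> lattice_omega N"
proof -
  obtain j where "h = 2 * j + 1"
    using assms(1) by (rule oddE)
  then have "z = of_int h * z + of_int (- j) * (2 * z)"
    by (simp add: algebra_simps)
  also have "\<dots> \<in> lattice_omega N"
    by (intro lattice_add lattice_of_int_mult assms)
  finally show ?thesis .
qed

lemma half_odd_plus_theta_in_lattice:
  fixes h :: int
  assumes "odd h"
  shows "(of_int h + theta N) / 2 \<in> lattice_omega N"
proof -
  obtain j where "h = 2 * j + 1"
    using assms by (rule oddE)
  then show ?thesis
    by (intro lattice_omegaI[of _ j 1]) (simp add: theta_conv_omega)
qed

lemma primitive_in_lattice: "primitive_in N z \<Longrightarrow> z \<in> lattice_omega N"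
  by (auto simp: primitive_in_def intro: lattice_omegaI)

lemma primitive_in_uminus: "primitive_in N (- z) \<longleftrightarrow> primitive_in N z"
proof -
  have "primitive_in N (- z)" if prim: "primitive_in N z" for z
  proof -
    obtain r s :: int where "z = of_int r + of_int s * omega N" "gcd r s = 1"
      using prim by (auto simp: primitive_in_def)
    then show ?thesis
      unfolding primitive_in_def by (intro exI[of _ "- r"] exI[of _ "- s"]) simp
  qed
  from this[of z] this[of "- z"] show ?thesis
    by auto
qed

text \<open>A Bezout combination of the coordinates \<open>t * r\<close> and \<open>t * s\<close>,
  both integers, equals \<open>t\<close>.\<close>

lemma primitive_multiple_int:
  fixes t :: real
  assumes "N > 0" "primitive_in N \<beta>" "of_real t * \<beta> \<in> lattice_omega N"
  shows "t \<in> \<int>"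
proof -
  obtain r s :: int where rs: "\<beta> = of_int r + of_int s * omega N" "gcd r s = 1"
    using assms(2) by (auto simp: primitive_in_def)
  obtain r' s' where rs': "of_real t * \<beta> = of_int r' + of_int s' * omega N"
    using assms(3) by (rule lattice_omegaE)
  have "of_real (t * r) + of_real (t * s) * omega N = of_real r' + of_real s' * omega N"
    using rs' by (simp add: rs(1) algebra_simps)
  from omega_coords_unique[OF assms(1) this] have eq: "t * r = r'" "t * s = s'"
    by auto
  obtain u v where "u * r + v * s = 1"
    using bezout_int[of r s] rs(2) by auto
  then have "real_of_int (u * r + v * s) = 1"
    by (simp only: of_int_1)
  then have "real_of_int u * r + real_of_int v * s = 1"
    by simp
  then have "t = t * (real_of_int u * r + real_of_int v * s)"
    by simp
  also have "\<dots> = u * (t * r) + v * (t * s)"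
    by (simp add: algebra_simps)
  also have "\<dots> \<in> \<int>"
    by (simp add: eq)
  finally show ?thesis .
qed

text \<open>The factor \<open>h\<close> is the content of \<open>z\<close>, the gcd of its two
  coordinates.\<close>

lemma lattice_content:
  assumes "z \<in> lattice_omega N" "z \<noteq> 0"
  obtains h :: nat and \<beta> where "h > 0" "primitive_in N \<beta>" "z = of_nat h * \<beta>"
proof -
  obtain r s where rs: "z = of_int r + of_int s * omega N"
    using assms(1) by (rule lattice_omegaE)
  define g where "g = gcd r s"
  have g: "g > 0"
    using assms(2) rs unfolding g_def gcd_pos_int by auto
  then have "gcd r s \<noteq> 0"
    unfolding g_def by linarith
  then obtain r' s' where rs': "r = r' * g" "s = s' * g" "coprime r' s'"
    using gcd_coprime_exists[of r s] unfolding g_def by blast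
  show ?thesis
  proof
    show "nat g > 0"
      using g by simp
    show "primitive_in N (of_int r' + of_int s' * omega N)"
      unfolding primitive_in_def using rs'(3) by (intro exI[of _ r'] exI[of _ s']) simp
    show "z = of_nat (nat g) * (of_int r' + of_int s' * omega N)"
      using g by (subst rs, subst rs'(1), subst rs'(2)) (simp add: algebra_simps)
  qed
qed

section \<open>Lattice points on the line \<open>\<gamma>/2 + \<tau> \<gamma> \<theta>\<close>\<close>

text \<open>Multiplying the given equation by \<theta> turns \<gamma>\<theta> into -N\<gamma>, so -N
  times the midpoint is \<open>h / 2\<close> times \<beta>\<theta>. As N is odd and twice the
  midpoint is \<gamma>, the midpoint itself lies in \<Lambda>.\<close>

lemma half_in_lattice_if_even:
  fixes h :: nat
  assumes "N mod 4 = 3" "\<gamma> \<in> lattice_omega N" "\<beta> \<in> lattice_omega N"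
    and "\<gamma> * theta N = of_nat h * \<beta>" "even h"
  shows "\<gamma> / 2 \<in> lattice_omega N"
proof (rule lattice_odd_multiple)
  have "N mod 2 = 1"
    using assms(1) by presburger
  then show "odd (- int N)"
    by auto
  obtain j where j: "h = 2 * j"
    using assms(5) by (rule evenE)
  have "of_int (- int N) * (\<gamma> / 2) = (\<gamma> * theta N) * theta N / 2"
    using theta_squared[of N] by (simp add: mult.assoc)
  also have "\<dots> = of_int (int j) * (\<beta> * theta N)"
    using assms(4) by (simp add: j)
  also have "\<dots> \<in> lattice_omega N"
    by (intro lattice_of_int_mult lattice_mult assms theta_in_lattice)
  finally show "of_int (- int N) * (\<gamma> / 2) \<in> lattice_omega N" .
  show "2 * (\<gamma> / 2) \<in> lattice_omega N"
    using assms(2) by simp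
qed

text \<open>Twice the point is \<gamma> + \<beta>, and \<open>h\<close> times it is \<gamma> times
  \<open>(h + theta N) / 2\<close>, which is in \<Lambda> for odd \<open>h\<close>.\<close>

lemma line_point_in_lattice:
  fixes h :: nat
  assumes "N mod 4 = 3" "\<gamma> \<in> lattice_omega N" "\<beta> \<in> lattice_omega N"
    and "\<gamma> * theta N = of_nat h * \<beta>" "odd h"
  shows "\<gamma> * (1/2 + of_real (1 / (2 * real h)) * theta N) \<in> lattice_omega N"
proof (rule lattice_odd_multiple)
  let ?z = "\<gamma> * (1/2 + of_real (1 / (2 * real h)) * theta N)"
  have h: "h > 0"
    using assms(5) by (rule odd_pos)
  have "2 * ?z = \<gamma> + (\<gamma> * theta N) / of_nat h"
    using h by (simp add: field_simps)
  also have "\<dots> = \<gamma> + \<beta>"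
    using h by (simp add: assms(4))
  also have "\<dots> \<in> lattice_omega N"
    by (intro lattice_add assms)
  finally show "2 * ?z \<in> lattice_omega N" .
  show odd: "odd (int h)"
    using assms(5) by simp
  have "of_int (int h) * ?z = \<gamma> * ((of_int (int h) + theta N) / 2)"
    using h by (simp add: field_simps)
  also have "\<dots> \<in> lattice_omega N"
    by (intro lattice_mult assms half_odd_plus_theta_in_lattice odd)
  finally show "of_int (int h) * ?z \<in> lattice_omega N" .
qed

text \<open>Twice the point minus \<gamma> is \<open>2 * \<tau> * h\<close> times the primitive
  \<beta>, so \<open>2 * \<tau> * h\<close> is an integer. It remains to see that this integer is
  not 0.\<close>

lemma line_point_distance:
  fixes h :: nat
  assumes "N > 0" "N mod 4 = 3" "\<gamma> \<in> lattice_omega N" "primitive_in N \<beta>"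
    and eq: "\<gamma> * theta N = of_nat h * \<beta>" and "odd h"
    and pt: "\<gamma> * (1/2 + of_real \<tau> * theta N) \<in> lattice_omega N"
  shows "1 / (2 * real h) \<le> \<bar>\<tau>\<bar>"
proof -
  have h: "h > 0"
    using assms(6) by (rule odd_pos)
  let ?z = "\<gamma> * (1/2 + of_real \<tau> * theta N)"
  have "of_real (2 * \<tau> * h) * \<beta> = of_real (2 * \<tau>) * (\<gamma> * theta N)"
    by (simp add: eq)
  also have "\<dots> = of_int 2 * ?z + (- \<gamma>)"
    by (simp add: algebra_simps)
  also have "\<dots> \<in> lattice_omega N"
    by (intro lattice_add lattice_of_int_mult lattice_uminus assms(3) pt)
  finally have "2 * \<tau> * h \<in> \<int>"
    by (rule primitive_multiple_int[OF assms(1,4)])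
  then obtain m where m: "2 * \<tau> * h = of_int m"
    by (auto elim: Ints_cases)
  \<comment> \<open>For \<open>m = 0\<close> the point is the midpoint \<gamma>/2; its product with
    \<theta> is \<open>h / 2\<close> times \<beta>, which would make \<open>h\<close> even.\<close>
  have "m \<noteq> 0"
  proof
    assume "m = 0"
    then have "\<tau> = 0"
      using m h by simp
    then have "\<gamma> / 2 \<in> lattice_omega N"
      using pt by simp
    then have "\<gamma> / 2 * theta N \<in> lattice_omega N"
      by (intro lattice_mult assms(2) theta_in_lattice)
    then have "of_real (h / 2) * \<beta> \<in> lattice_omega N"
      using eq by simp
    then have "real h / 2 \<in> \<int>"
      by (rule primitive_multiple_int[OF assms(1,4)])
    then obtain j :: int where "real h / 2 = of_int j"
      by (auto elim: Ints_cases)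
    then have "int h = 2 * j"
      by linarith
    with \<open>odd h\<close> show False
      by (metis dvd_triv_left even_of_nat)
  qed
  then have "1 \<le> \<bar>of_int m :: real\<bar>"
    by linarith
  then have "1 \<le> 2 * \<bar>\<tau>\<bar> * h"
    by (simp add: m[symmetric] abs_mult)
  then show ?thesis
    using h by (simp add: field_simps)
qed

text \<open>For \<gamma> = \<alpha>e and the bound \<open>c\<close> that belongs to
  \<open>e\<close>, these points form the edge that the cell of \<alpha>\<Lambda> at 0 shares with
  the cell at \<gamma>. The parameter \<tau> is measured from the midpoint, so \<open>c\<close> is
  half the length of the edge in units of the norm of \<gamma>\<theta>.\<close>

definition edge_meets :: "nat \<Rightarrow> complex \<Rightarrow> real \<Rightarrow> bool" where
  "edge_meets N \<gamma> c \<longleftrightarrow>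
    (\<exists>\<tau>. \<bar>\<tau>\<bar> \<le> c \<and> \<gamma> * (1/2 + of_real \<tau> * theta N) \<in> lattice_omega N)"

lemma edge_meets_if_even:
  fixes h :: nat
  assumes "N mod 4 = 3" "\<gamma> \<in> lattice_omega N" "primitive_in N \<beta>"
    and "\<gamma> * theta N = of_nat h * \<beta>" "even h" "c \<ge> 0"
  shows "edge_meets N \<gamma> c"
  unfolding edge_meets_def
  using half_in_lattice_if_even[of N \<gamma> \<beta> h] assms primitive_in_lattice
  by (intro exI[of _ 0]) auto

lemma edge_meets_iff_odd:
  fixes h :: nat
  assumes "N > 0" "N mod 4 = 3" "\<gamma> \<in> lattice_omega N" "primitive_in N \<beta>"
    and "\<gamma> * theta N = of_nat h * \<beta>" "odd h"
  shows "edge_meets N \<gamma> c \<longleftrightarrow> 1 / (2 * real h) \<le> c"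
proof
  assume "edge_meets N \<gamma> c"
  then show "1 / (2 * real h) \<le> c"
    using line_point_distance[OF assms] unfolding edge_meets_def by force
next
  assume "1 / (2 * real h) \<le> c"
  then show "edge_meets N \<gamma> c"
    unfolding edge_meets_def
    using line_point_in_lattice[OF assms(2,3) primitive_in_lattice[OF assms(4)] assms(5,6)]
    by (intro exI[of _ "1 / (2 * real h)"]) auto
qed

lemma theta_nonzero: "N > 0 \<Longrightarrow> theta N \<noteq> 0"
  by (simp add: theta_eq complex_eq_iff)

text \<open>The bound \<open>c\<close> satisfies \<open>1/6 \<le> c < 1/2\<close>. Hence content 1
  puts the nearest lattice points beyond the ends of the edge, whereas every odd content from 3 on
  puts them on it.\<close>

lemma edge_meets_one:
  assumes "N > 0" "N mod 4 = 3" "\<gamma> \<in> lattice_omega N" "\<gamma> \<noteq> 0"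
  shows "\<not> edge_meets N \<gamma> ((real N - 1) / (4 * real N)) \<longleftrightarrow> primitive_in N (\<gamma> * theta N)"
proof
  have N: "N \<ge> 3"
    using assms(2) by presburger
  let ?c = "(real N - 1) / (4 * real N)"
  {
    assume "primitive_in N (\<gamma> * theta N)"
    then have "edge_meets N \<gamma> ?c \<longleftrightarrow> 1 / (2 * real 1) \<le> ?c"
      by (intro edge_meets_iff_odd[OF assms(1-3)]) simp_all
    then show "\<not> edge_meets N \<gamma> ((real N - 1) / (4 * real N))"
      using N by (simp add: field_simps)
  }
  assume ne: "\<not> edge_meets N \<gamma> ((real N - 1) / (4 * real N))"
  have "\<gamma> * theta N \<in> lattice_omega N"
    by (intro lattice_mult assms theta_in_lattice)
  moreover have "\<gamma> * theta N \<noteq> 0"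
    using assms(1,4) theta_nonzero by simp
  ultimately obtain h \<beta> where h: "h > 0" "primitive_in N \<beta>" "\<gamma> * theta N = of_nat h * \<beta>"
    by (rule lattice_content)
  have "?c \<ge> 0"
    using N by simp
  then have odd: "odd h"
    using edge_meets_if_even[OF assms(2,3) h(2,3)] ne by blast
  then have "1 / (2 * real h) > ?c"
    using edge_meets_iff_odd[OF assms(1-3) h(2,3) odd] ne by (metis not_le)
  \<comment> \<open>Equality holds for \<open>N = 3\<close>, the smallest admissible value.\<close>
  moreover have "?c \<ge> 1 / 6"
    using N by (simp add: field_simps)
  ultimately have "1 / (2 * real h) > 1 / 6"
    by linarith
  then have "h < 3"
    using h(1) by (simp add: field_simps)
  then have "h = 1"
    using odd by presburger
  then show "primitive_in N (\<gamma> * theta N)"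
    using h by simp
qed

lemma dvd_if_primitive_multiple:
  fixes k M :: nat
  assumes "N > 0" "k > 0" "primitive_in N \<beta>" "\<delta> \<in> lattice_omega N"
    and eq: "of_nat M * \<beta> = of_nat k * \<delta>"
  shows "k dvd M"
proof -
  have "of_real (M / k) * \<beta> = \<delta>"
    using eq assms(2) by (simp add: nonzero_divide_eq_eq mult.commute)
  then have "real M / k \<in> \<int>"
    using primitive_multiple_int[OF assms(1,3)] assms(4) by simp
  then obtain j where "real M / k = of_int j"
    by (auto elim: Ints_cases)
  then have "real M = of_int (int k * j)"
    using assms(2) by (simp add: field_simps)
  then have "int M = int k * j"
    by linarith
  then show ?thesis
    by (metis dvd_triv_left int_dvd_int_iff)
qed

text \<open>Here \<open>e\<close> and \<open>e'\<close> stand for \<omega> and its conjugate in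
  either order. A suitable \<open>k\<close> is the content of \<alpha>e\<theta>; if it is odd, the
  edge avoids \<Lambda> exactly when \<open>k < N\<close>.\<close>

lemma edge_meets_oblique:
  assumes "N > 0" "N mod 4 = 3" "\<alpha> \<in> lattice_omega N" "\<alpha> \<noteq> 0"
    and e: "e \<in> lattice_omega N" "e' \<in> lattice_omega N" "e * e' = of_nat M" "N + 1 = 4 * M"
    and prim: "primitive_in N (\<alpha> * theta N)"
  shows "\<not> edge_meets N (\<alpha> * e) (1 / (2 * real N)) \<longleftrightarrow>
    (\<exists>k::nat. odd k \<and> k dvd N + 1 \<and> primitive_in N (\<alpha> * (e * theta N) / of_nat k))"
proof
  have M: "M > 0" "M < N"
    using assms(1,2) e(4) by presburger+
  have in_lat: "\<alpha> * e \<in> lattice_omega N" "\<alpha> * e * theta N \<in> lattice_omega N"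
    by (intro lattice_mult assms theta_in_lattice)+
  {
    assume "\<exists>k::nat. odd k \<and> k dvd N + 1 \<and> primitive_in N (\<alpha> * (e * theta N) / of_nat k)"
    then obtain k :: nat where k: "odd k" "k dvd N + 1"
      "primitive_in N (\<alpha> * (e * theta N) / of_nat k)"
      by blast
    \<comment> \<open>Since \<open>k\<close> is odd and divides \<open>4 * M\<close>, it divides
      \<open>M\<close>. This gives \<open>k \<le> M < N\<close>, so the points at distance
      \<open>1 / (2 * k)\<close> are beyond the ends of the edge.\<close>
    have "coprime k (2 * 2)"
      unfolding coprime_mult_right_iff using k(1) by simp
    moreover have "k dvd (2 * 2) * M"
      using k(2) e(4) by simp
    ultimately have "k dvd M"
      using coprime_dvd_mult_right_iff by blast
    then have "k \<le> M"
      using M(1) by (rule dvd_imp_le)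
    then have "k < N" "k > 0"
      using M(2) k(1) odd_pos by simp_all
    moreover have "edge_meets N (\<alpha> * e) (1 / (2 * real N)) \<longleftrightarrow> 1 / (2 * real k) \<le> 1 / (2 * real N)"
      using \<open>k > 0\<close>
      by (intro edge_meets_iff_odd[OF assms(1,2) in_lat(1) k(3) _ k(1)]) (simp add: mult.assoc)
    ultimately show "\<not> edge_meets N (\<alpha> * e) (1 / (2 * real N))"
      by (simp add: field_simps)
  }
  assume ne: "\<not> edge_meets N (\<alpha> * e) (1 / (2 * real N))"
  have "e \<noteq> 0"
    using e(3) M by auto
  then have "\<alpha> * e * theta N \<noteq> 0"
    using assms(1,4) theta_nonzero by simp
  then obtain k \<beta> where k: "k > 0" "primitive_in N \<beta>" "\<alpha> * e * theta N = of_nat k * \<beta>"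
    using lattice_content in_lat(2) by metis
  have odd: "odd k"
    using edge_meets_if_even[OF assms(2) in_lat(1) k(2,3)] ne by force
  \<comment> \<open>Multiplication by \<open>e'\<close> brings in the primitive element
    \<alpha>\<theta>: its multiple by \<open>M\<close> is divisible by \<open>k\<close> in
    \<Lambda>, hence \<open>k\<close> divides \<open>M\<close>.\<close>
  have "of_nat M * (\<alpha> * theta N) = (\<alpha> * e * theta N) * e'"
    by (simp add: e(3)[symmetric] mult_ac)
  also have "\<dots> = of_nat k * (\<beta> * e')"
    by (simp add: k(3))
  finally have "k dvd M"
    using dvd_if_primitive_multiple[OF assms(1) k(1) prim]
      lattice_mult[OF assms(2) primitive_in_lattice[OF k(2)] e(2)] by blast
  then have "k dvd N + 1"
    unfolding e(4) by (rule dvd_mult)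
  moreover have "\<alpha> * (e * theta N) / of_nat k = \<beta>"
    using k(1,3) by (simp add: mult.assoc)
  then have "primitive_in N (\<alpha> * (e * theta N) / of_nat k)"
    using k(2) by (rule ssubst)
  ultimately show "\<exists>k::nat. odd k \<and> k dvd N + 1 \<and> primitive_in N (\<alpha> * (e * theta N) / of_nat k)"
    using odd by blast
qed

section \<open>The Voronoi cells of \<open>\<alpha> \<Lambda>\<close>\<close>

lemma closed_voronoi_cell: "closed (voronoi_cell L p)"
proof -
  have "voronoi_cell L p = (\<Inter>q\<in>L. {x. dist x p \<le> dist x q})"
    by (auto simp: voronoi_cell_def)
  moreover have "closed {x. dist x p \<le> dist x q}" for q
    by (intro closed_Collect_le continuous_intros)
  ultimately show ?thesis
    by (simp add: closed_INT)
qed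

text \<open>An arbitrarily small move from \<open>x\<close> in the direction \<open>q - p\<close>
  makes the point strictly closer to \<open>q\<close> than to \<open>p\<close> and so leaves the
  cell.\<close>

lemma equidistant_in_frontier:
  fixes x p q :: "'a::real_inner"
  assumes "x \<in> voronoi_cell L p" "q \<in> L" "q \<noteq> p" "dist x p = dist x q"
  shows "x \<in> frontier (voronoi_cell L p)"
proof -
  have "x \<notin> interior (voronoi_cell L p)"
  proof
    assume "x \<in> interior (voronoi_cell L p)"
    then obtain d where d: "d > 0" "ball x d \<subseteq> voronoi_cell L p"
      by (auto simp: mem_interior)
    define v where "v = q - p"
    \<comment> \<open>The move \<open>t *\<^sub>R v\<close> has length \<open>d / 2\<close>, so it
      stays inside the ball.\<close>
    define t where "t = d / (2 * norm v)"
    have v: "norm v > 0"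
      using assms(3) by (simp add: v_def)
    then have t: "t > 0"
      using d(1) by (simp add: t_def)
    have "norm (t *\<^sub>R v) < d"
      using v d(1) by (simp add: t_def)
    then have "x + t *\<^sub>R v \<in> ball x d"
      by (simp add: dist_norm)
    then have "x + t *\<^sub>R v \<in> voronoi_cell L p"
      using d(2) by blast
    then have "norm (x - p + t *\<^sub>R v) \<le> norm (x - q + t *\<^sub>R v)"
      using assms(2) by (auto simp: voronoi_cell_def dist_norm algebra_simps)
    then have "(x - p + t *\<^sub>R v) \<bullet> (x - p + t *\<^sub>R v) \<le> (x - q + t *\<^sub>R v) \<bullet> (x - q + t *\<^sub>R v)"
      by (simp add: norm_le)
    moreover have "(x - p) \<bullet> (x - p) = (x - q) \<bullet> (x - q)"
      using assms(4) by (simp add: dist_norm norm_eq)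
    ultimately have "2 * t * ((x - p) \<bullet> v) \<le> 2 * t * ((x - q) \<bullet> v)"
      by (simp add: inner_add inner_commute)
    then have "(x - p) \<bullet> v \<le> (x - q) \<bullet> v"
      using t by simp
    then have "v \<bullet> v \<le> 0"
      by (simp add: v_def inner_diff)
    then show False
      using v by (metis inner_gt_zero_iff not_le zero_less_norm_iff)
  qed
  then show ?thesis
    using assms(1) closure_subset by (auto simp: frontier_def)
qed

section \<open>The Voronoi cell of \<Lambda> at 0 as a hexagon\<close>

definition hexagon :: "nat \<Rightarrow> complex set" where
  "hexagon N = {u. \<bar>Re u\<bar> \<le> 1/2 \<and> \<bar>Re u\<bar> + sqrt N * \<bar>Im u\<bar> \<le> (real N + 1) / 4}"

text \<open>For a lattice vector with coordinates \<open>m / 2\<close> and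
  \<open>n * sqrt N / 2\<close> this is the half-plane condition, with \<open>Y\<close> in the role
  of \<open>sqrt N * \<bar>Im u\<bar>\<close>. It follows from the two inequalities of the hexagon
  with nonnegative weights: \<open>n\<close> and \<open>m - n\<close> if \<open>n \<le> m\<close>,
  otherwise \<open>n\<close> for the second one together with \<open>0 \<le> x\<close>.\<close>

lemma hexagon_inequality:
  fixes x Y :: real and m n N :: nat
  assumes "0 \<le> x" "x \<le> 1/2" "x + Y \<le> (real N + 1) / 4" "N > 0" "even (m + n)"
  shows "real m * x + real n * Y \<le> (real m^2 + real N * real n^2) / 4"
proof (cases "n \<le> m")
  case True
  then obtain d where d: "m = n + d"
    using le_Suc_ex by blast
  have "real n * (x + Y) + real d * x \<le> real n * ((real N + 1) / 4) + real d * (1/2)"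
    using assms by (intro add_mono mult_left_mono) auto
  moreover have "real n * (real N + 1) + 2 * real d \<le> real m^2 + real N * real n^2"
  proof -
    \<comment> \<open>Parity rules out the only natural number for which
      \<open>2 * d \<le> d * d\<close> fails.\<close>
    have "d \<noteq> 1"
      using assms(5) d by auto
    then have "2 * d \<le> d * d"
      by (cases d) auto
    moreover have "n \<le> n * n" "N * n \<le> N * (n * n)"
      by auto
    moreover have "m^2 + N * n^2 = n * n + 2 * (n * d) + d * d + N * (n * n)"
      by (simp add: d power2_eq_square algebra_simps)
    moreover have "n * (N + 1) + 2 * d = n + N * n + 2 * d"
      by simp
    ultimately have "n * (N + 1) + 2 * d \<le> m^2 + N * n^2"
      by linarith
    then show ?thesis
      by (metis (mono_tags) of_nat_le_iff of_nat_add of_nat_mult of_nat_1 of_nat_numeral of_nat_power)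
  qed
  ultimately show ?thesis
    by (simp add: d field_simps)
next
  case False
  then obtain d where d: "n = m + d"
    using le_Suc_ex nat_le_linear by blast
  have "real n * (x + Y) \<le> real n * ((real N + 1) / 4)"
    using assms by (intro mult_left_mono) auto
  moreover have "0 \<le> real d * x"
    using assms by simp
  moreover have "real n * (real N + 1) \<le> real m^2 + real N * real n^2"
  proof -
    \<comment> \<open>Since \<open>m < n\<close> have equal parity, \<open>n\<close> is at least 2;
      this absorbs the term \<open>n\<close> into \<open>N * n * n\<close>.\<close>
    have "n \<ge> 2"
      using assms(5) d False by presburger
    then have "n + N * n \<le> N * n * 2"
      using assms(4) by (cases N) auto
    also have "\<dots> \<le> N * n * n"
      using \<open>n \<ge> 2\<close> by simp
    also have "\<dots> \<le> m^2 + N * n^2"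
      by (simp add: power2_eq_square)
    finally have "n * (N + 1) \<le> m^2 + N * n^2"
      by (simp add: algebra_simps)
    then show ?thesis
      by (metis (mono_tags) of_nat_le_iff of_nat_add of_nat_mult of_nat_1 of_nat_power)
  qed
  ultimately show ?thesis
    by (simp add: d field_simps)
qed

lemma norm_le_diff_iff:
  "norm u \<le> norm (u - q) \<longleftrightarrow> 2 * (Re u * Re q + Im u * Im q) \<le> (Re q)^2 + (Im q)^2"
  by (simp add: cmod_def power2_eq_square algebra_simps)

text \<open>The six vectors \<open>1\<close>, \<omega>, its conjugate and their negatives yield the
  inequalities of the hexagon, the bound \<open>(N + 1) / 4\<close> being the squared norm of
  \<omega>. All other lattice vectors impose only consequences of these.\<close>

lemma hexagon_iff_nearest:
  assumes "N > 0"
  shows "u \<in> hexagon N \<longleftrightarrow> (\<forall>q\<in>lattice_omega N. norm u \<le> norm (u - q))"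
proof
  assume u: "u \<in> hexagon N"
  show "\<forall>q\<in>lattice_omega N. norm u \<le> norm (u - q)"
  proof
    fix q assume "q \<in> lattice_omega N"
    then obtain r s where q: "q = of_int r + of_int s * omega N"
      by (rule lattice_omegaE)
    \<comment> \<open>The doubled real part; it has the same parity as \<open>s\<close>, as
      \<open>hexagon_inequality\<close> requires.\<close>
    define m where "m = 2 * r + s"
    have Re: "Re q = m / 2" and Im: "Im q = s * sqrt N / 2"
      by (auto simp: q omega_eq m_def)
    have "real (nat \<bar>m\<bar>) * \<bar>Re u\<bar> + real (nat \<bar>s\<bar>) * (sqrt N * \<bar>Im u\<bar>)
        \<le> (real (nat \<bar>m\<bar>) ^ 2 + N * real (nat \<bar>s\<bar>) ^ 2) / 4"
    proof (rule hexagon_inequality)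
      show "even (nat \<bar>m\<bar> + nat \<bar>s\<bar>)"
        by (auto simp: m_def even_nat_iff)
    qed (use u assms in \<open>auto simp: hexagon_def\<close>)
    moreover have "m * Re u \<le> \<bar>m\<bar> * \<bar>Re u\<bar>" "s * (sqrt N * Im u) \<le> \<bar>s\<bar> * (sqrt N * \<bar>Im u\<bar>)"
      using abs_ge_self[of "m * Re u"] abs_ge_self[of "s * (sqrt N * Im u)"]
      by (simp_all add: abs_mult)
    ultimately have "m * Re u + s * (sqrt N * Im u) \<le> (m^2 + N * s^2) / 4"
      by simp
    moreover have "2 * (Re u * Re q + Im u * Im q) = m * Re u + s * (sqrt N * Im u)"
      by (simp add: Re Im)
    moreover have "(Re q)^2 + (Im q)^2 = (m^2 + N * s^2) / 4"
      by (simp add: Re Im power_divide power_mult_distrib)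
    ultimately show "norm u \<le> norm (u - q)"
      by (simp add: norm_le_diff_iff)
  qed
next
  assume near: "\<forall>q\<in>lattice_omega N. norm u \<le> norm (u - q)"
  have ineq: "2 * (Re u * Re q + Im u * Im q) \<le> (Re q)^2 + (Im q)^2"
    if "q \<in> {1, -1, omega N, - omega N, cnj (omega N), - cnj (omega N)}" for q
  proof -
    have "q \<in> lattice_omega N"
      using that of_int_in_lattice[of 1] of_int_in_lattice[of "-1"] omega_in_lattice
        cnj_omega_in_lattice lattice_uminus by auto
    then show ?thesis
      using near by (simp add: norm_le_diff_iff)
  qed
  have "Re u \<le> 1/2" "- Re u \<le> 1/2"
    using ineq[of 1] ineq[of "-1"] by auto
  moreover have "Re u + sqrt N * Im u \<le> (real N + 1) / 4" "- Re u - sqrt N * Im u \<le> (real N + 1) / 4"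
    "Re u - sqrt N * Im u \<le> (real N + 1) / 4" "- Re u + sqrt N * Im u \<le> (real N + 1) / 4"
    using ineq[of "omega N"] ineq[of "- omega N"] ineq[of "cnj (omega N)"]
      ineq[of "- cnj (omega N)"]
    by (simp_all add: omega_eq power_divide algebra_simps)
  moreover have "sqrt N * \<bar>Im u\<bar> = \<bar>sqrt N * Im u\<bar>"
    by (simp add: abs_mult)
  ultimately show "u \<in> hexagon N"
    unfolding hexagon_def by auto
qed

text \<open>Multiplication by \<alpha> scales all distances by the same factor, and \<Lambda> is
  invariant under translation by \<open>w\<close>.\<close>

lemma voronoi_cell_scaled:
  assumes "N > 0" "\<alpha> \<noteq> 0" "w \<in> lattice_omega N"
  shows "x \<in> voronoi_cell ((\<lambda>z. \<alpha> * z) ` lattice_omega N) (\<alpha> * w) \<longleftrightarrow> x / \<alpha> - w \<in> hexagon N"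
proof -
  define u where "u = x / \<alpha> - w"
  have x: "x = \<alpha> * (w + u)"
    using assms(2) by (simp add: u_def)
  have dist: "dist x (\<alpha> * q) = norm \<alpha> * norm (u - (q - w))" for q
  proof -
    have "x - \<alpha> * q = \<alpha> * (u - (q - w))"
      by (subst x) (simp add: algebra_simps)
    then show ?thesis
      by (simp only: dist_norm norm_mult)
  qed
  have "x \<in> voronoi_cell ((\<lambda>z. \<alpha> * z) ` lattice_omega N) (\<alpha> * w)
      \<longleftrightarrow> (\<forall>q\<in>lattice_omega N. norm u \<le> norm (u - (q - w)))"
    using assms(2) by (simp add: voronoi_cell_def dist)
  also have "\<dots> \<longleftrightarrow> (\<forall>q\<in>lattice_omega N. norm u \<le> norm (u - q))"
  proof safe
    fix q assume *: "\<forall>q\<in>lattice_omega N. norm u \<le> norm (u - (q - w))" "q \<in> lattice_omega N"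
    then have "norm u \<le> norm (u - (q + w - w))"
      using lattice_add assms(3) by blast
    then show "norm u \<le> norm (u - q)"
      by simp
  next
    fix q assume *: "\<forall>q\<in>lattice_omega N. norm u \<le> norm (u - q)" "q \<in> lattice_omega N"
    then show "norm u \<le> norm (u - (q - w))"
      using lattice_add[OF *(2) lattice_uminus[OF assms(3)]] by simp
  qed
  also have "\<dots> \<longleftrightarrow> u \<in> hexagon N"
    using hexagon_iff_nearest[OF assms(1)] by simp
  finally show ?thesis
    by (simp add: u_def)
qed

text \<open>The strict inequalities define an open subset of the cell, hence a part of its interior;
  at a frontier point one of them must be an equality.\<close>

lemma frontier_voronoi_cell_scaled:
  assumes "N > 0" "\<alpha> \<noteq> 0" "w \<in> lattice_omega N"
    and x: "x \<in> frontier (voronoi_cell ((\<lambda>z. \<alpha> * z) ` lattice_omega N) (\<alpha> * w))"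
    and u: "u = x / \<alpha> - w"
  shows "u \<in> hexagon N \<and> (\<bar>Re u\<bar> = 1/2 \<or> \<bar>Re u\<bar> + sqrt N * \<bar>Im u\<bar> = (real N + 1) / 4)"
proof -
  let ?V = "voronoi_cell ((\<lambda>z. \<alpha> * z) ` lattice_omega N) (\<alpha> * w)"
  let ?S = "{x. \<bar>Re (x / \<alpha> - w)\<bar> < 1/2 \<and>
    \<bar>Re (x / \<alpha> - w)\<bar> + sqrt N * \<bar>Im (x / \<alpha> - w)\<bar> < (real N + 1) / 4}"
  have "open ?S"
    by (intro open_Collect_conj open_Collect_less continuous_intros) (use assms(2) in auto)
  moreover have "?S \<subseteq> ?V"
    unfolding voronoi_cell_scaled[OF assms(1-3)] subset_eq hexagon_def mem_Collect_eq
    by (blast intro: less_imp_le)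
  ultimately have "?S \<subseteq> interior ?V"
    using interior_maximal by blast
  then have "x \<notin> ?S"
    using x unfolding frontier_def by blast
  moreover have "x \<in> ?V"
    using x frontier_subset_closed[OF closed_voronoi_cell] by blast
  then have "u \<in> hexagon N"
    using voronoi_cell_scaled[OF assms(1-3)] u by blast
  ultimately show ?thesis
    unfolding hexagon_def u mem_Collect_eq by linarith
qed

section \<open>Parametrization of the edges of the hexagon\<close>

lemma vertical_edge_in_hexagon:
  assumes "N > 0" "\<bar>\<tau>\<bar> \<le> (real N - 1) / (4 * real N)"
  shows "1/2 + of_real \<tau> * theta N \<in> hexagon N"
proof -
  have "sqrt N * \<bar>\<tau> * sqrt N\<bar> = N * \<bar>\<tau>\<bar>"
    by (simp add: abs_mult)
  moreover have "N * \<bar>\<tau>\<bar> \<le> (real N - 1) / 4"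
    using assms by (simp add: of_nat_diff field_simps)
  ultimately show ?thesis
    by (simp add: hexagon_def theta_eq field_simps)
qed

lemma oblique_edge_in_hexagon:
  assumes "N > 0" "\<bar>\<tau>\<bar> \<le> 1 / (2 * real N)"
  shows "omega N * (1/2 + of_real \<tau> * theta N) \<in> hexagon N"
proof -
  let ?u = "omega N * (1/2 + of_real \<tau> * theta N)"
  \<comment> \<open>With these coordinates \<open>Re ?u + sqrt N * Im ?u\<close> is
    \<open>(N + 1) / 4\<close> for every \<tau>, and the bound on \<tau> says that the real part is
    between 0 and 1/2.\<close>
  have Re: "Re ?u = 1/4 - N * \<tau> / 2" and Im: "Im ?u = sqrt N * (1/4 + \<tau> / 2)"
    by (simp_all add: omega_eq theta_eq field_simps)
  have "\<bar>N * \<tau>\<bar> \<le> 1/2"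
    using assms by (simp add: abs_mult field_simps)
  moreover have "1 / (2 * real N) \<le> 1/2"
    using assms(1) by (simp add: field_simps)
  then have "\<bar>\<tau>\<bar> \<le> 1/2"
    using assms(2) by linarith
  moreover have "sqrt N * \<bar>sqrt N * (1/4 + \<tau> / 2)\<bar> = N * \<bar>1/4 + \<tau> / 2\<bar>"
    by (simp add: abs_mult)
  ultimately show ?thesis
    unfolding hexagon_def mem_Collect_eq Re Im by (auto simp: field_simps)
qed

lemma cnj_hexagon: "cnj u \<in> hexagon N \<longleftrightarrow> u \<in> hexagon N"
  by (simp add: hexagon_def)

lemma uminus_hexagon: "- u \<in> hexagon N \<longleftrightarrow> u \<in> hexagon N"
  by (simp add: hexagon_def)

lemma cnj_theta: "cnj (theta N) = - theta N"
  by (simp add: theta_eq complex_eq_iff)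

lemma cnj_oblique_edge_in_hexagon:
  assumes "N > 0" "\<bar>\<tau>\<bar> \<le> 1 / (2 * real N)"
  shows "cnj (omega N) * (1/2 + of_real \<tau> * theta N) \<in> hexagon N"
proof -
  have "cnj (omega N * (1/2 + of_real (- \<tau>) * theta N)) \<in> hexagon N"
    using assms by (subst cnj_hexagon, intro oblique_edge_in_hexagon) auto
  then show ?thesis
    by (simp add: cnj_theta)
qed

lemma oblique_edge_coords:
  assumes "N > 0" "0 \<le> Re u" "Re u \<le> 1/2" "Re u + sqrt N * Im u = (real N + 1) / 4"
  obtains \<tau> where "\<bar>\<tau>\<bar> \<le> 1 / (2 * real N)" "u = omega N * (1/2 + of_real \<tau> * theta N)"
proof
  \<comment> \<open>The solution of \<open>Re u = 1/4 - N * \<tau> / 2\<close>; the ends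
    \<open>Re u = 0\<close> and \<open>Re u = 1/2\<close> of the edge give
    \<open>\<tau> = 1 / (2 * N)\<close> and its negative.\<close>
  define \<tau> where "\<tau> = (1/4 - Re u) * 2 / N"
  have "\<bar>1/4 - Re u\<bar> \<le> 1/4"
    using assms(2,3) unfolding abs_le_iff by simp
  then show "\<bar>\<tau>\<bar> \<le> 1 / (2 * real N)"
    using assms(1) by (simp add: \<tau>_def abs_mult field_simps)
  have "sqrt N * (sqrt N * (1/4 + \<tau> / 2)) = N * (1/4 + \<tau> / 2)"
    by simp
  also have "\<dots> = (real N + 1) / 4 - Re u"
    using assms(1) by (simp add: \<tau>_def field_simps)
  also have "\<dots> = sqrt N * Im u"
    using assms(4) by linarith
  finally have "Im u = sqrt N * (1/4 + \<tau> / 2)"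
    using assms(1) by simp
  moreover have "Re u = 1/4 - N * \<tau> / 2"
    using assms(1) by (simp add: \<tau>_def field_simps)
  ultimately show "u = omega N * (1/2 + of_real \<tau> * theta N)"
    by (simp add: complex_eq_iff omega_eq theta_eq field_simps)
qed

text \<open>In the right half-plane three edges remain; the sign of \<open>Im u\<close> separates
  the two oblique ones, which conjugation exchanges.\<close>

lemma hexagon_boundary_cases:
  assumes "N > 0" "u \<in> hexagon N" "Re u \<ge> 0"
    and "\<bar>Re u\<bar> = 1/2 \<or> \<bar>Re u\<bar> + sqrt N * \<bar>Im u\<bar> = (real N + 1) / 4"
  obtains (vertical) \<tau> where "\<bar>\<tau>\<bar> \<le> (real N - 1) / (4 * real N)" "u = 1/2 + of_real \<tau> * theta N"
  | (oblique) \<tau> where "\<bar>\<tau>\<bar> \<le> 1 / (2 * real N)" "u = omega N * (1/2 + of_real \<tau> * theta N)"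
  | (cnj_oblique) \<tau> where "\<bar>\<tau>\<bar> \<le> 1 / (2 * real N)" "u = cnj (omega N) * (1/2 + of_real \<tau> * theta N)"
proof -
  have half: "Re u \<le> 1/2"
    using assms by (simp add: hexagon_def)
  consider "Re u = 1/2"
    | "Re u + sqrt N * Im u = (real N + 1) / 4"
    | "Re u + sqrt N * Im (cnj u) = (real N + 1) / 4"
    using assms(3,4) by (cases "Im u \<ge> 0") auto
  then show ?thesis
  proof cases
    case 1
    have "sqrt N * \<bar>Im u\<bar> \<le> (real N - 1) / 4"
      using assms(2) 1 by (simp add: hexagon_def field_simps)
    then have "\<bar>Im u\<bar> \<le> (real N - 1) / 4 / sqrt N"
      using assms(1) by (simp add: field_simps)
    then have "\<bar>Im u\<bar> / sqrt N \<le> (real N - 1) / 4 / sqrt N / sqrt N"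
      by (intro divide_right_mono) auto
    also have "\<dots> = (real N - 1) / (4 * real N)"
      by (simp add: field_simps)
    finally have "\<bar>Im u / sqrt N\<bar> \<le> (real N - 1) / (4 * real N)"
      using assms(1) by (simp add: of_nat_diff)
    then show ?thesis
      by (rule vertical) (use 1 assms(1) in \<open>simp add: complex_eq_iff theta_eq\<close>)
  next
    case 2
    with assms half show ?thesis
      by (metis oblique_edge_coords oblique)
  next
    case 3
    then obtain \<tau> where \<tau>: "\<bar>\<tau>\<bar> \<le> 1 / (2 * real N)" "cnj u = omega N * (1/2 + of_real \<tau> * theta N)"
      using oblique_edge_coords[of N "cnj u"] assms half by auto
    have "u = cnj (cnj u)"
      by simp
    also have "\<dots> = cnj (omega N) * (1/2 + of_real (- \<tau>) * theta N)"
      unfolding \<tau>(2) by (simp add: cnj_theta)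
    finally show ?thesis
      using \<tau>(1) by (intro cnj_oblique[of "- \<tau>"]) auto
  qed
qed

section \<open>Cleanness in terms of the edges\<close>

lemma norm_edge_point:
  "norm (e * (1/2 + of_real \<tau> * theta N)) = norm (e * (1/2 + of_real \<tau> * theta N) - e)"
proof -
  \<comment> \<open>As \<theta> is purely imaginary, subtracting 1 from a number with real part 1/2
    amounts to conjugating and negating it.\<close>
  have "e * (1/2 + of_real \<tau> * theta N) - e = - e * cnj (1/2 + of_real \<tau> * theta N)"
    by (simp add: cnj_theta algebra_simps)
  then show ?thesis
    by (simp only: norm_mult norm_minus_cancel complex_mod_cnj)
qed

text \<open>A point of \<Lambda> on the scaled edge belongs to the cell at 0 and is equidistant from
  0 and \<alpha>e, so it is on the frontier.\<close>

lemma not_clean_if_edge_meets: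
  assumes "N > 0" "\<alpha> \<noteq> 0" "e \<in> lattice_omega N" "e \<noteq> 0"
    and hex: "\<And>\<tau>. \<bar>\<tau>\<bar> \<le> c \<Longrightarrow> e * (1/2 + of_real \<tau> * theta N) \<in> hexagon N"
    and meets: "edge_meets N (\<alpha> * e) c"
  shows "\<not> clean_in (lattice_omega N) ((\<lambda>z. \<alpha> * z) ` lattice_omega N)"
proof -
  let ?L = "(\<lambda>z. \<alpha> * z) ` lattice_omega N"
  obtain \<tau> where \<tau>: "\<bar>\<tau>\<bar> \<le> c" "\<alpha> * e * (1/2 + of_real \<tau> * theta N) \<in> lattice_omega N"
    using meets by (auto simp: edge_meets_def)
  define u where "u = e * (1/2 + of_real \<tau> * theta N)"
  have zero: "0 \<in> lattice_omega N"
    using of_int_in_lattice[of 0] by simp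
  have "\<alpha> * u \<in> frontier (voronoi_cell ?L (\<alpha> * 0))"
  proof (rule equidistant_in_frontier)
    show "\<alpha> * u \<in> voronoi_cell ?L (\<alpha> * 0)"
      using voronoi_cell_scaled[OF assms(1,2) zero] hex[OF \<tau>(1)] assms(2) by (simp add: u_def)
    show "\<alpha> * e \<in> ?L" "\<alpha> * e \<noteq> \<alpha> * 0"
      using assms by auto
    have "norm u = norm (u - e)"
      unfolding u_def by (rule norm_edge_point)
    then show "dist (\<alpha> * u) (\<alpha> * 0) = dist (\<alpha> * u) (\<alpha> * e)"
      by (simp add: dist_norm norm_mult right_diff_distrib[symmetric])
  qed
  moreover have "\<alpha> * u \<in> lattice_omega N"
    using \<tau>(2) by (simp add: u_def mult.assoc)
  ultimately show ?thesis
    using zero unfolding clean_in_def by blast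
qed

text \<open>Three edges of the cell at 0 represent all edges of all cells: translations by elements
  of \<alpha>\<Lambda> and the map -1 preserve \<Lambda> and permute the cells.\<close>

lemma clean_iff_no_edge_meets:
  assumes "N > 0" "N mod 4 = 3" "\<alpha> \<in> lattice_omega N" "\<alpha> \<noteq> 0"
  shows "clean_in (lattice_omega N) ((\<lambda>z. \<alpha> * z) ` lattice_omega N) \<longleftrightarrow>
    \<not> edge_meets N \<alpha> ((real N - 1) / (4 * real N)) \<and>
    \<not> edge_meets N (\<alpha> * omega N) (1 / (2 * real N)) \<and>
    \<not> edge_meets N (\<alpha> * cnj (omega N)) (1 / (2 * real N))" (is "?clean \<longleftrightarrow> ?free")
proof
  assume ?clean
  have "1 \<in> lattice_omega N"
    using of_int_in_lattice[of 1] by simp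
  moreover have "omega N \<noteq> 0"
    by (simp add: omega_eq complex_eq_iff)
  ultimately show ?free
    using \<open>?clean\<close> not_clean_if_edge_meets[OF assms(1,4), of 1 "(real N - 1) / (4 * real N)"]
      not_clean_if_edge_meets[OF assms(1,4) omega_in_lattice, of "1 / (2 * real N)"]
      not_clean_if_edge_meets[OF assms(1,4) cnj_omega_in_lattice, of "1 / (2 * real N)"]
      vertical_edge_in_hexagon[OF assms(1)] oblique_edge_in_hexagon[OF assms(1)]
      cnj_oblique_edge_in_hexagon[OF assms(1)]
    by auto
next
  assume free: ?free
  show ?clean
    unfolding clean_in_def
  proof (intro ballI equals0I)
    fix p x
    assume "p \<in> (\<lambda>z. \<alpha> * z) ` lattice_omega N"
      and x: "x \<in> frontier (voronoi_cell ((\<lambda>z. \<alpha> * z) ` lattice_omega N) p) \<inter> lattice_omega N"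
    then obtain w where w: "w \<in> lattice_omega N" "p = \<alpha> * w"
      by blast
    define u where "u = x / \<alpha> - w"
    have bd: "u \<in> hexagon N \<and> (\<bar>Re u\<bar> = 1/2 \<or> \<bar>Re u\<bar> + sqrt N * \<bar>Im u\<bar> = (real N + 1) / 4)"
      using frontier_voronoi_cell_scaled[OF assms(1,4) w(1)] x u_def w(2) by blast
    have "\<alpha> * u = x + - (\<alpha> * w)"
      using assms(4) by (simp add: u_def algebra_simps)
    then have lat: "\<alpha> * u \<in> lattice_omega N"
      using x lattice_add lattice_uminus lattice_mult[OF assms(2,3) w(1)] by (metis IntD2)
    \<comment> \<open>Passing to the opposite edge if necessary moves the point to the right
      half-plane.\<close>
    define v where "v = (if Re u \<ge> 0 then u else - u)"
    have v: "v \<in> hexagon N" "Re v \<ge> 0"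
      "\<bar>Re v\<bar> = 1/2 \<or> \<bar>Re v\<bar> + sqrt N * \<bar>Im v\<bar> = (real N + 1) / 4"
      using bd by (auto simp: v_def uminus_hexagon)
    have lat: "\<alpha> * v \<in> lattice_omega N"
      using lat lattice_uminus[OF lat] by (simp add: v_def)
    from assms(1) v show False
    proof (cases rule: hexagon_boundary_cases)
      case (vertical \<tau>)
      then show False
        using free lat unfolding edge_meets_def by blast
    next
      case (oblique \<tau>)
      then show False
        using free lat unfolding edge_meets_def mult.assoc by blast
    next
      case (cnj_oblique \<tau>)
      then show False
        using free lat unfolding edge_meets_def mult.assoc by blast
    qed
  qed
qed

theorem theorem6:
  fixes N :: nat and a b :: int and \<alpha> :: complex
  assumes "N > 0" and "N mod 4 = 3"
    and "\<alpha> = of_int a + of_int b * omega N" and "\<alpha> \<noteq> 0"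
  shows "clean_in (lattice_omega N) ((\<lambda>z. \<alpha> * z) ` lattice_omega N) \<longleftrightarrow>
    primitive_in N (\<alpha> * theta N) \<and>
    (\<exists>k::nat. odd k \<and> k dvd N + 1 \<and>
       \<alpha> * (of_nat N - theta N) / (2 * of_nat k) \<in> lattice_omega N \<and>
       primitive_in N (\<alpha> * (of_nat N - theta N) / (2 * of_nat k))) \<and>
    (\<exists>k::nat. odd k \<and> k dvd N + 1 \<and>
       \<alpha> * (of_nat N + theta N) / (2 * of_nat k) \<in> lattice_omega N \<and>
       primitive_in N (\<alpha> * (of_nat N + theta N) / (2 * of_nat k)))"
proof -
  have \<alpha>: "\<alpha> \<in> lattice_omega N"
    using assms(3) by (rule lattice_omegaI)
  obtain M where M: "N + 1 = 4 * M"
    using assms(2) by (rule mod_four_three_obtain)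
  have cnj_norm: "cnj (omega N) * omega N = of_nat M"
    using omega_times_cnj[OF M] by (simp add: mult.commute)
  have minus: "\<alpha> * (of_nat N - theta N) / (2 * of_nat k) = - (\<alpha> * (omega N * theta N) / of_nat k)"
    for k :: nat
    by (simp add: omega_times_theta)
  have plus: "\<alpha> * (of_nat N + theta N) / (2 * of_nat k) = \<alpha> * (cnj (omega N) * theta N) / of_nat k"
    for k :: nat
    by (simp add: cnj_omega_times_theta)
  have redundant: "z \<in> lattice_omega N \<and> primitive_in N z \<longleftrightarrow> primitive_in N z" for z
    using primitive_in_lattice by blast
  show ?thesis
  \<comment> \<open>The criterion for the oblique edges presupposes that \<alpha>\<theta> is
    primitive. If it is not, the vertical edge meets \<Lambda> and both sides are false.\<close>
  proof (cases "primitive_in N (\<alpha> * theta N)")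
    case True
    show ?thesis
      unfolding clean_iff_no_edge_meets[OF assms(1,2) \<alpha> assms(4)]
        edge_meets_one[OF assms(1,2) \<alpha> assms(4)] redundant
      unfolding minus plus primitive_in_uminus
        edge_meets_oblique[OF assms(1,2) \<alpha> assms(4) omega_in_lattice cnj_omega_in_lattice
          omega_times_cnj[OF M] M True]
        edge_meets_oblique[OF assms(1,2) \<alpha> assms(4) cnj_omega_in_lattice omega_in_lattice
          cnj_norm M True] ..
  next
    case False
    then show ?thesis
      unfolding clean_iff_no_edge_meets[OF assms(1,2) \<alpha> assms(4)]
        edge_meets_one[OF assms(1,2) \<alpha> assms(4)] by blast
  qed
qed

end
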